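(* For all ordinals $\alpha, \beta < \omega^\omega$ and all natural numbers $n$, $$\begin{pmatrix} \omega\alpha \\ \omega\beta \end{pmatrix} \longrightarrow \begin{pmatrix} \omega\alpha & n \\ \omega\beta & n \end{pmatrix}.$$
   Context: An order type is an isomorphism class of linearly ordered sets; ordinals (in particular natural numbers) are regarded as order types. Products and powers are ordinal products and powers: $\omega\alpha$ is the order type of $\alpha$ many consecutive copies of $\omega$, and $\omega^\omega$ is ordinal exponentiation. For order types $\alpha,\beta,\gamma,\delta,\varepsilon,\zeta$, the polarised partition relation $$\begin{pmatrix} \alpha \\ \beta \end{pmatrix} \longrightarrow \begin{pmatrix} \gamma & \varepsilon \\ \delta & \zeta \end{pmatrix}$$ means: for all linearly ordered sets $A$ of order type $\alpha$ and $B$ of order type $\beta$ and every colouring $c\colon A\times B\to\{0,1\}$, either there are $C\subseteq A$ of order type $\gamma$ and $D\subseteq B$ of order type $\delta$ with $c[C\times D]\subseteq\{0\}$, or there are $E\subseteq A$ of order type $\varepsilon$ and $Z\subseteq B$ of order type $\zeta$ with $c[E\times Z]\subseteq\{1\}$ (subsets carry the induced order). *)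

theory Defs
  imports Main
begin

text \<open>
  A linearly ordered set is a reflexive linear order \<open>r :: 'a rel\<close> on the set \<open>Field r\<close>
  (\<open>Linear_order r\<close>), and an ordinal is given by any well-order (\<open>Well_order r\<close>) of that type.
  Thus \<open>\<omega>\<close> is \<open>natLeq\<close>, the natural number \<open>n\<close> is \<open>natLeq_on n\<close>, and \<open>\<alpha> < \<beta>\<close> is
  \<open>(\<alpha>, \<beta>) \<in> ordLess\<close>.
\<close>

definition same_order_type :: "'a rel \<Rightarrow> 'b rel \<Rightarrow> bool" where
  "same_order_type r s \<longleftrightarrow> Linear_order r \<and> Linear_order s \<and> (\<exists>f. iso r s f)"

text \<open>The product \<open>r s\<close> is \<open>s\<close> many consecutive copies of \<open>r\<close>: the second component decides first.\<close>

definition order_mult :: "'a rel \<Rightarrow> 'b rel \<Rightarrow> ('a \<times> 'b) rel" where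
  "order_mult r s =
     {((x, y), (x', y')). x \<in> Field r \<and> x' \<in> Field r \<and> y \<in> Field s \<and> y' \<in> Field s \<and>
        ((y, y') \<in> s \<and> y \<noteq> y' \<or> y = y' \<and> (x, x') \<in> r)}"

text \<open>
  The power \<open>r\<^sup>s\<close> consists of the functions from \<open>Field s\<close> to \<open>Field r\<close> that take a non-least
  value only finitely often, compared at the \<open>s\<close>-largest argument at which they differ.
\<close>

definition finite_support_funs :: "'a rel \<Rightarrow> 'b rel \<Rightarrow> ('b \<Rightarrow> 'a) set" where
  "finite_support_funs r s =
     {f \<in> Func (Field s) (Field r). finite {y \<in> Field s. underS r (f y) \<noteq> {}}}"

definition order_pow :: "'a rel \<Rightarrow> 'b rel \<Rightarrow> ('b \<Rightarrow> 'a) rel" where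
  "order_pow r s =
     {(f, g). f \<in> finite_support_funs r s \<and> g \<in> finite_support_funs r s \<and>
        (f = g \<or>
         (\<exists>y \<in> Field s. (f y, g y) \<in> r \<and> f y \<noteq> g y \<and>
            (\<forall>z \<in> Field s. (y, z) \<in> s \<and> y \<noteq> z \<longrightarrow> f z = g z)))}"

text \<open>
  In \<open>polarised_partition \<alpha> \<beta> \<gamma> \<delta> \<epsilon> \<zeta>\<close> the left column of the right-hand side is \<open>(\<gamma>, \<delta>)\<close> and the
  right column is \<open>(\<epsilon>, \<zeta>)\<close>.  A definition cannot quantify over types, so the types carrying
  \<open>A\<close> and \<open>B\<close> are parameters; a theorem that is polymorphic in them ranges over all linearly
  ordered sets of the required order types.
\<close>

definition polarised_partition ::
  "'x itself \<Rightarrow> 'y itself \<Rightarrow> 'a rel \<Rightarrow> 'b rel \<Rightarrow> 'c rel \<Rightarrow> 'd rel \<Rightarrow> 'e rel \<Rightarrow> 'f rel \<Rightarrow> bool" where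
  "polarised_partition (_ :: 'x itself) (_ :: 'y itself) \<alpha> \<beta> \<gamma> \<delta> \<epsilon> \<zeta> \<longleftrightarrow>
     (\<forall>(A :: 'x rel) (B :: 'y rel) (c :: 'x \<times> 'y \<Rightarrow> nat).
        same_order_type A \<alpha> \<and> same_order_type B \<beta> \<and> c ` (Field A \<times> Field B) \<subseteq> {0, 1} \<longrightarrow>
        (\<exists>C D. C \<subseteq> Field A \<and> same_order_type (Restr A C) \<gamma> \<and>
               D \<subseteq> Field B \<and> same_order_type (Restr B D) \<delta> \<and> c ` (C \<times> D) \<subseteq> {0}) \<or>
        (\<exists>E Z. E \<subseteq> Field A \<and> same_order_type (Restr A E) \<epsilon> \<and>
               Z \<subseteq> Field B \<and> same_order_type (Restr B Z) \<zeta> \<and> c ` (E \<times> Z) \<subseteq> {1}))"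

end

theory Submission
  imports Defs "HOL-Library.Ramsey"
begin

text \<open>
  The ordinal \<open>\<omega>\<alpha>\<close> with \<open>\<alpha> < \<omega>\<^sup>\<omega>\<close> is a finite sum of powers \<open>\<omega>\<^sup>k\<close> with \<open>k \<ge> 1\<close>, and \<open>\<omega>\<^sup>k\<close>
  is the order type of the \<open>k\<close>-element subsets of any infinite set of natural numbers, written
  increasingly and ordered lexicographically.  So a point of \<open>\<omega>\<alpha>\<close> is named by one of finitely many
  summands \<open>p\<close> and a finite set \<open>S\<close> of the size \<open>d p \<ge> 1\<close> that belongs to \<open>p\<close>, and for every
  infinite \<open>H\<close> the points named by subsets of \<open>H\<close> include a copy of the whole of \<open>\<omega>\<alpha>\<close>
  (\<open>omega_multiple_pieces\<close>).  Thin copies of \<open>\<omega>\<alpha>\<close> and \<open>\<omega>\<beta>\<close> are thus obtained by passing to thin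
  sets of naturals, which is where Ramsey's theorem applies.

  Fix summands \<open>p\<close> of \<open>\<omega>\<alpha>\<close> and \<open>q\<close> of \<open>\<omega>\<beta>\<close>.  A pair of disjoint sets \<open>S\<close>, \<open>T\<close> of sizes
  \<open>k = d p\<close> and \<open>l = d' q\<close> is the same as a \<open>(k + l)\<close>-element set \<open>S \<union> T\<close> together with a pattern:
  the set \<open>I\<close> of positions that the elements of \<open>S\<close> occupy in the increasing list of \<open>S \<union> T\<close>.
  There are finitely many triples \<open>(p, q, I)\<close>, so Ramsey's theorem gives an infinite \<open>H\<close> on which
  the colour of disjoint \<open>S\<close>, \<open>T\<close> depends on \<open>(p, q, I)\<close> only.  A triple of colour 1 would produce
  an \<open>n\<close> by \<open>n\<close> rectangle of colour 1 (\<open>homogeneous_pattern_contains_square\<close>), so unless there is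
  such a rectangle all disjoint pairs in \<open>H\<close> have colour 0
  (\<open>square_free_imp_disjoint_independent\<close>).  Splitting \<open>H\<close> into two disjoint infinite sets and
  taking the copy of \<open>\<omega>\<alpha>\<close> from one and the copy of \<open>\<omega>\<beta>\<close> from the other then makes all the pairs
  that occur disjoint.

  The Cantor normal form is not computed.  An ordinal below \<open>\<omega>\<^sup>\<omega>\<close> is an initial segment of the order
  of finitely supported functions on the naturals, so \<open>\<omega>\<alpha>\<close> is the set of all \<open>h\<close> below some \<open>F\<close> in
  the order by the largest difference, with \<open>F 0 = 0\<close> because of the factor \<open>\<omega>\<close>.  The summands are
  the pairs \<open>(y, v)\<close> of the largest place \<open>y\<close> where \<open>h\<close> and \<open>F\<close> differ and the value
  \<open>v = h y < F y\<close>; below \<open>y\<close> the function \<open>h\<close> is arbitrary, which is a copy of \<open>\<omega>\<^sup>y\<close>.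
\<close>

section \<open>Homogeneous sets for a bipartite colouring of finite sets\<close>

text \<open>
  Each Ramsey step passes to a smaller set, on which the homogeneity already obtained survives.
\<close>

lemma simultaneous_Ramsey:
  fixes P :: "'t \<Rightarrow> nat set \<Rightarrow> bool" and r :: "'t \<Rightarrow> nat"
  assumes "finite T" and "infinite Z"
  shows "\<exists>H\<subseteq>Z. infinite H \<and>
    (\<forall>t\<in>T. (\<forall>X\<in>nsets H (r t). P t X) \<or> (\<forall>X\<in>nsets H (r t). \<not> P t X))"
  using assms(1)
proof induction
  case empty
  then show ?case using assms(2) by blast
next
  case (insert t T)
  then obtain H where H: "H \<subseteq> Z" "infinite H"
    "\<forall>t\<in>T. (\<forall>X\<in>nsets H (r t). P t X) \<or> (\<forall>X\<in>nsets H (r t). \<not> P t X)" by blast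
  obtain Y c where Y: "Y \<subseteq> H" "infinite Y"
    "(\<lambda>X. of_bool (P t X) :: nat) ` nsets Y (r t) \<subseteq> {c}"
    by (rule Ramsey_nsets[OF H(2), of "\<lambda>X. of_bool (P t X)" "r t" 2]) (auto simp: of_bool_def)
  have "(\<forall>X\<in>nsets Y (r t). P t X) \<or> (\<forall>X\<in>nsets Y (r t). \<not> P t X)"
    using Y(3) by (cases "c = 1") (auto simp: image_subset_iff of_bool_def split: if_splits)
  moreover have "nsets Y k \<subseteq> nsets H k" for k using Y(1) by (rule nsets_mono)
  ultimately have "\<forall>s\<in>insert t T. (\<forall>X\<in>nsets Y (r s). P s X) \<or> (\<forall>X\<in>nsets Y (r s). \<not> P s X)"
    using H(3) by blast
  then show ?case using Y(1,2) H(1) by blast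
qed

lemma sorted_list_of_set_strict_mono_image:
  fixes f :: "nat \<Rightarrow> nat"
  assumes "strict_mono_on {..<n} f"
  shows "sorted_list_of_set (f ` {..<n}) = map f [0..<n]"
proof -
  have "card (f ` {..<n}) = n"
    using strict_mono_on_imp_inj_on[OF assms] by (simp add: card_image)
  moreover have "sorted_wrt (<) (map f [0..<n])"
    using assms by (auto simp: sorted_wrt_iff_nth_less strict_mono_on_def)
  ultimately show ?thesis
    by (subst sorted_list_of_set_unique[symmetric]) (auto simp: lessThan_atLeast0)
qed

text \<open>
  Here \<open>I\<close> is a pattern: \<open>Q\<close> relates the elements at the positions in \<open>I\<close> to those at the other
  positions, for every \<open>N\<close>-element subset of \<open>H\<close>.  To get a square, cut \<open>H\<close> into \<open>N\<close> consecutive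
  blocks of \<open>n\<close> elements; \<open>S i\<close> takes the \<open>i\<close>-th element of each block whose number is in \<open>I\<close>,
  and \<open>T j\<close> the \<open>j\<close>-th element of each of the other blocks.  Since comparing elements of different
  blocks amounts to comparing the blocks, every \<open>S i \<union> T j\<close> realises the same pattern.  Both sides of the
  pattern must be nonempty for the \<open>S i\<close>, and the \<open>T j\<close>, to be distinct.
\<close>

lemma homogeneous_pattern_contains_square:
  fixes Q :: "nat set \<Rightarrow> nat set \<Rightarrow> bool" and n :: nat
  assumes H: "infinite H" and I: "I \<subseteq> {..<N}" and k: "0 < card I" "card I < N"
    and hom: "\<And>X. X \<in> nsets H N \<Longrightarrow>
      Q (nth (sorted_list_of_set X) ` I) (nth (sorted_list_of_set X) ` ({..<N} - I))"
  shows "\<exists>S T. inj_on S {..<n} \<and> inj_on T {..<n} \<and>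
      (\<forall>i<n. S i \<in> nsets H (card I)) \<and> (\<forall>j<n. T j \<in> nsets H (N - card I)) \<and>
      (\<forall>i<n. \<forall>j<n. Q (S i) (T j))"
proof -
  \<comment> \<open>element \<open>i\<close> of block \<open>p\<close>\<close>
  define e where "e p i = enumerate H (p * n + i)" for p i
  have e_less: "e p i < e q j" if "p < q" "i < n" for p q i j
  proof -
    have "p * n + i < Suc p * n" using that by simp
    also have "\<dots> \<le> q * n" using that by (intro mult_le_mono1) simp
    finally show ?thesis using H by (auto simp: e_def)
  qed
  have e_H: "e p i \<in> H" for p i using H by (simp add: e_def enumerate_in_set)
  have e_eq: "e p i = e q j \<longleftrightarrow> p = q \<and> i = j" if "i < n" "j < n" for p q i j
  proof (cases p q rule: linorder_cases)
    case equal
    then show ?thesis using H by (simp add: e_def inj_enumerate inj_eq)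
  qed (use e_less[of p q i j] e_less[of q p j i] that in auto)
  define S where "S = (\<lambda>i. (\<lambda>p. e p i) ` I)"
  define T where "T = (\<lambda>j. (\<lambda>p. e p j) ` ({..<N} - I))"
  have card_S: "card (S i) = card I" if "i < n" for i
    unfolding S_def using that by (intro card_image inj_onI) (simp add: e_eq)
  have fin: "finite I" using I finite_subset by blast
  have cI: "card ({..<N} - I) = N - card I" using I fin by (simp add: card_Diff_subset)
  have card_T: "card (T j) = N - card I" if "j < n" for j
    unfolding T_def using that cI by (subst card_image) (auto intro!: inj_onI simp: e_eq)
  have inj: "inj_on (\<lambda>i. (\<lambda>p. e p i) ` J) {..<n}" if "J \<noteq> {}" for J
  proof (rule inj_onI)
    fix i j assume ij: "i \<in> {..<n}" "j \<in> {..<n}" "(\<lambda>p. e p i) ` J = (\<lambda>p. e p j) ` J"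
    from that obtain p where "p \<in> J" by blast
    with ij(3) have "e p i \<in> (\<lambda>p. e p j) ` J" by blast
    with ij show "i = j" by (auto simp: e_eq)
  qed
  have Q: "Q (S i) (T j)" if "i < n" "j < n" for i j
  proof -
    define f where "f p = e p (if p \<in> I then i else j)" for p
    have f: "strict_mono_on {..<N} f"
      unfolding f_def strict_mono_on_def using that by (auto intro!: e_less)
    have X: "f ` {..<N} \<in> nsets H N"
      using card_image[OF strict_mono_on_imp_inj_on[OF f]] e_H by (auto simp: nsets_def f_def)
    have nth: "sorted_list_of_set (f ` {..<N}) ! p = f p" if "p < N" for p
      using that by (simp add: sorted_list_of_set_strict_mono_image[OF f])
    have im: "nth (sorted_list_of_set (f ` {..<N})) ` J = f ` J" if "J \<subseteq> {..<N}" for J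
      using that by (intro image_cong) (auto simp: nth)
    have "f ` I = S i" "f ` ({..<N} - I) = T j" by (auto simp: S_def T_def f_def)
    then show ?thesis using hom[OF X] im[OF I] im[of "{..<N} - I"] by simp
  qed
  have "card I \<noteq> 0" "card ({..<N} - I) \<noteq> 0" using k cI by simp_all
  then have "I \<noteq> {}" "{..<N} - I \<noteq> {}" by (metis card.empty)+
  from inj[OF this(1)] inj[OF this(2)] have "inj_on S {..<n}" "inj_on T {..<n}" unfolding S_def T_def .
  moreover have "S i \<in> nsets H (card I)" if "i < n" for i
    using card_S[OF that] e_H fin by (auto simp: nsets_def S_def)
  moreover have "T j \<in> nsets H (N - card I)" if "j < n" for j
    using card_T[OF that] e_H by (auto simp: nsets_def T_def)
  ultimately show ?thesis using Q by blast
qed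

text \<open>
  In the application \<open>P\<close> and \<open>P'\<close> are the sets of summands, and \<open>Q p q S T\<close> says that the points
  named by \<open>(p, S)\<close> and \<open>(q, T)\<close> have colour 1.  Disjointness of \<open>S\<close> and \<open>T\<close> cannot be dropped:
  the relation \<open>S = T\<close> contains no \<open>2\<close> by \<open>2\<close> square, yet holds within every \<open>H\<close>.
\<close>

lemma square_free_imp_disjoint_independent:
  fixes Q :: "'p \<Rightarrow> 'q \<Rightarrow> nat set \<Rightarrow> nat set \<Rightarrow> bool" and n :: nat
  assumes fin: "finite P" "finite P'"
    and pos: "\<And>p. p \<in> P \<Longrightarrow> 0 < d p" "\<And>q. q \<in> P' \<Longrightarrow> 0 < d' q"
    and free: "\<And>p q S T. p \<in> P \<Longrightarrow> q \<in> P' \<Longrightarrow>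
      inj_on S {..<n} \<Longrightarrow> inj_on T {..<n} \<Longrightarrow>
      (\<And>i. i < n \<Longrightarrow> S i \<in> nsets UNIV (d p)) \<Longrightarrow> (\<And>j. j < n \<Longrightarrow> T j \<in> nsets UNIV (d' q)) \<Longrightarrow>
      (\<And>i j. i < n \<Longrightarrow> j < n \<Longrightarrow> Q p q (S i) (T j)) \<Longrightarrow> False"
  shows "\<exists>H. infinite H \<and> (\<forall>p\<in>P. \<forall>q\<in>P'. \<forall>S\<in>nsets H (d p). \<forall>T\<in>nsets H (d' q).
           S \<inter> T = {} \<longrightarrow> \<not> Q p q S T)"
proof -
  define patterns where "patterns = (SIGMA p:P. SIGMA q:P'. {I. I \<subseteq> {..<d p + d' q} \<and> card I = d p})"
  define R where "R = (\<lambda>(p, q, I) X. Q p q (nth (sorted_list_of_set X) ` I)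
    (nth (sorted_list_of_set X) ` ({..<d p + d' q} - I)))"
  have "finite patterns" unfolding patterns_def using fin by auto
  from simultaneous_Ramsey[OF this infinite_UNIV_nat, of "\<lambda>(p, q, I). d p + d' q" R]
  obtain H where H: "infinite H" and hom: "\<And>p q I. (p, q, I) \<in> patterns \<Longrightarrow>
      (\<forall>X\<in>nsets H (d p + d' q). R (p, q, I) X) \<or> (\<forall>X\<in>nsets H (d p + d' q). \<not> R (p, q, I) X)"
    by fastforce
  have neg: "\<not> R (p, q, I) X" if pat: "(p, q, I) \<in> patterns" and X: "X \<in> nsets H (d p + d' q)"
    for p q I X
  proof
    assume "R (p, q, I) X"
    then have all: "\<And>X. X \<in> nsets H (d p + d' q) \<Longrightarrow> R (p, q, I) X" using hom[OF pat] X by blast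
    have I: "p \<in> P" "q \<in> P'" "I \<subseteq> {..<d p + d' q}" "card I = d p"
      using pat by (auto simp: patterns_def)
    have "\<exists>S T. inj_on S {..<n} \<and> inj_on T {..<n} \<and>
      (\<forall>i<n. S i \<in> nsets H (card I)) \<and> (\<forall>j<n. T j \<in> nsets H (d p + d' q - card I)) \<and>
      (\<forall>i<n. \<forall>j<n. Q p q (S i) (T j))"
      using homogeneous_pattern_contains_square[OF H I(3), of "Q p q" n] all I pos
      by (auto simp: R_def)
    then obtain S T where "inj_on S {..<n}" "inj_on T {..<n}"
      "\<forall>i<n. S i \<in> nsets H (d p)" "\<forall>j<n. T j \<in> nsets H (d' q)" "\<forall>i<n. \<forall>j<n. Q p q (S i) (T j)"
      using I by auto
    then show False using free[OF I(1,2), of S T] nsets_mono[of H UNIV] by blast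
  qed
  have "\<not> Q p q S T"
    if pq: "p \<in> P" "q \<in> P'" and S: "S \<in> nsets H (d p)" and T: "T \<in> nsets H (d' q)"
      and disj: "S \<inter> T = {}" for p q S T
  proof -
    define xs where "xs = sorted_list_of_set (S \<union> T)"
    define I where "I = {i. i < d p + d' q \<and> xs ! i \<in> S}"
    have card: "card (S \<union> T) = d p + d' q"
      using S T disj by (auto simp: nsets_def card_Un_disjoint)
    have set_xs: "set xs = S \<union> T" and len: "length xs = d p + d' q" and dist: "distinct xs"
      using S T card by (auto simp: xs_def nsets_def)
    have im_S: "nth xs ` I = S"
      using set_xs len by (auto simp: I_def in_set_conv_nth image_iff set_eq_iff)(metis)
    have im_T: "nth xs ` ({..<d p + d' q} - I) = T"
    proof -
      have "nth xs ` ({..<d p + d' q} - I) = set xs - S"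
        using len by (auto simp: I_def in_set_conv_nth image_iff)
      then show ?thesis using set_xs disj by blast
    qed
    have "inj_on (nth xs) I" using dist len by (auto simp: I_def inj_on_def nth_eq_iff_index_eq)
    then have "card I = d p" using im_S S card_image[of "nth xs" I] by (simp add: nsets_def)
    then have "(p, q, I) \<in> patterns" using pq by (auto simp: patterns_def I_def)
    moreover have "S \<union> T \<in> nsets H (d p + d' q)" using S T card by (auto simp: nsets_def)
    ultimately have "\<not> R (p, q, I) (S \<union> T)" by (rule neg)
    then show ?thesis using im_S im_T by (simp add: R_def xs_def)
  qed
  then show ?thesis using H by blast
qed

lemma infinite_split_nat:
  fixes H :: "nat set"
  assumes "infinite H"
  shows "\<exists>H\<^sub>1 H\<^sub>2. H\<^sub>1 \<subseteq> H \<and> H\<^sub>2 \<subseteq> H \<and> infinite H\<^sub>1 \<and> infinite H\<^sub>2 \<and> H\<^sub>1 \<inter> H\<^sub>2 = {}"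
proof (intro exI conjI)
  let ?e = "enumerate H"
  show "range (\<lambda>i. ?e (2 * i)) \<subseteq> H" "range (\<lambda>i. ?e (2 * i + 1)) \<subseteq> H"
    using assms enumerate_in_set by auto
  show "infinite (range (\<lambda>i. ?e (2 * i)))" "infinite (range (\<lambda>i. ?e (2 * i + 1)))"
    by (auto intro!: range_inj_infinite injI dest!: injD[OF inj_enumerate[OF assms]])
  show "range (\<lambda>i. ?e (2 * i)) \<inter> range (\<lambda>i. ?e (2 * i + 1)) = {}"
    using inj_enumerate[OF assms] by (auto simp: inj_eq) presburger
qed

section \<open>Order types\<close>

text \<open>
  To find a subset of the same order type it suffices to find a strictly increasing self-map, so no
  order type has to be computed.
\<close>

lemma same_order_type_strict_mono_image:
  assumes A: "same_order_type A X"
    and into: "\<theta> ` Field A \<subseteq> Field A"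
    and mono: "\<And>x y. x \<in> Field A \<Longrightarrow> y \<in> Field A \<Longrightarrow> (x, y) \<in> A \<Longrightarrow> x \<noteq> y \<Longrightarrow>
                 (\<theta> x, \<theta> y) \<in> A \<and> \<theta> x \<noteq> \<theta> y"
  shows "same_order_type (Restr A (\<theta> ` Field A)) X"
proof -
  have lin: "Linear_order A" "Linear_order X" using A by (auto simp: same_order_type_def)
  then have refl: "Refl A" and tot: "Total A" and anti: "antisym A"
    by (auto simp: order_on_defs)
  from A obtain f where f: "bij_betw f (Field A) (Field X)"
    "\<And>x y. x \<in> Field A \<Longrightarrow> y \<in> Field A \<Longrightarrow> (x, y) \<in> A \<longleftrightarrow> (f x, f y) \<in> X"
    unfolding same_order_type_def iso_iff2 by blast
  have inj: "inj_on \<theta> (Field A)"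
    using mono tot unfolding inj_on_def total_on_def by metis
  have iff: "(\<theta> x, \<theta> y) \<in> A \<longleftrightarrow> (x, y) \<in> A" if "x \<in> Field A" "y \<in> Field A" for x y
  proof
    assume "(\<theta> x, \<theta> y) \<in> A"
    then show "(x, y) \<in> A"
      using mono[OF that(2,1)] tot anti refl that unfolding total_on_def antisym_def refl_on_def by metis
  next
    assume "(x, y) \<in> A"
    then show "(\<theta> x, \<theta> y) \<in> A"
      using mono[OF that] into refl that unfolding refl_on_def by blast
  qed
  define g where "g = inv_into (Field A) \<theta>"
  have g: "bij_betw g (\<theta> ` Field A) (Field A)" "\<And>x. x \<in> Field A \<Longrightarrow> g (\<theta> x) = x"
    using inj by (auto simp: g_def bij_betw_inv_into inj_on_imp_bij_betw)
  have field: "Field (Restr A (\<theta> ` Field A)) = \<theta> ` Field A"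
    using refl into by (rule Refl_Field_Restr2)
  have "iso (Restr A (\<theta> ` Field A)) X (f \<circ> g)"
    unfolding iso_iff2 field using bij_betw_trans[OF g(1) f(1)] by (auto simp: g(2) iff f(2))
  then show ?thesis using lin Linear_order_Restr by (auto simp: same_order_type_def)
qed

lemma same_order_type_finite_Restr:
  assumes lin: "Linear_order A" and E: "E \<subseteq> Field A" "finite E" "card E = n"
  shows "same_order_type (Restr A E) (natLeq_on n)"
proof -
  have field: "Field (Restr A E) = E"
    using lin E(1) by (intro Refl_Field_Restr2) (auto simp: order_on_defs)
  have "finite (Restr A E)" using finite_SigmaI[OF E(2), of "\<lambda>_. E"] E(2) by simp
  then have "well_order_on E (Restr A E)"
    using Linear_order_Restr[OF lin, of E] linear_order_on_well_order_on field by metis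
  then have "(Restr A E, card_of E) \<in> ordIso"
    by (rule finite_well_order_on_ordIso[OF E(2) _ card_of_well_order_on])
  moreover have "(card_of E, card_of {x. x < n}) \<in> ordIso"
    using E(2,3) by (simp add: card_of_ordIso[symmetric] bij_betw_iff_card)
  moreover have "(card_of {x. x < n}, natLeq_on n) \<in> ordIso"
    by (rule finite_well_order_on_ordIso[OF _ card_of_well_order_on natLeq_on_well_order_on]) simp
  ultimately have "(Restr A E, natLeq_on n) \<in> ordIso" by (blast intro: ordIso_transitive)
  then show ?thesis
    unfolding ordIso_def same_order_type_def well_order_on_def by auto
qed

section \<open>Antilexicographic coordinates\<close>

text \<open>
  On finitely supported functions this is the strict order of the ordinal power \<open>\<omega>\<^sup>\<omega>\<close>.  Finite support
  is left out of the definition because it is inherited downwards from an upper bound.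
\<close>

definition antilex :: "(nat \<Rightarrow> nat) \<Rightarrow> (nat \<Rightarrow> nat) \<Rightarrow> bool" where
  "antilex h k \<longleftrightarrow> (\<exists>p. h p < k p \<and> (\<forall>z>p. h z = k z))"

lemma antilex_irrefl: "\<not> antilex h h" by (auto simp: antilex_def)

text \<open>
  Prepending a value at place 0, the least significant one, multiplies by \<open>\<omega>\<close> on the left.
\<close>

lemma antilex_case_nat:
  "antilex (case_nat m g) (case_nat m' g') \<longleftrightarrow> antilex g g' \<or> g = g' \<and> m < m'"
proof
  assume "antilex (case_nat m g) (case_nat m' g')"
  then obtain p where p: "case_nat m g p < case_nat m' g' p"
    "\<And>z. z > p \<Longrightarrow> case_nat m g z = case_nat m' g' z" unfolding antilex_def by blast
  show "antilex g g' \<or> g = g' \<and> m < m'"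
  proof (cases p)
    case 0
    then have "g z = g' z" for z using p(2)[of "Suc z"] by simp
    then show ?thesis using p(1) 0 by auto
  next
    case (Suc q)
    then have "g z = g' z" if "z > q" for z using p(2)[of "Suc z"] that by simp
    then show ?thesis using p(1) Suc by (auto simp: antilex_def)
  qed
next
  assume "antilex g g' \<or> g = g' \<and> m < m'"
  then show "antilex (case_nat m g) (case_nat m' g')"
  proof
    assume "antilex g g'"
    then obtain p where "g p < g' p" "\<forall>z>p. g z = g' z" unfolding antilex_def by blast
    then show ?thesis unfolding antilex_def
      by (intro exI[of _ "Suc p"]) (auto split: nat.split simp: Suc_less_eq2)
  qed (auto simp: antilex_def split: nat.split intro!: exI[of _ 0])
qed

lemma finite_support_antilex:
  assumes "finite {i. G i \<noteq> 0}" and "antilex g G"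
  shows "finite {i. g i \<noteq> (0::nat)}"
proof -
  obtain p where "\<forall>z>p. g z = G z" using assms(2) by (auto simp: antilex_def)
  then have "{i. g i \<noteq> 0} \<subseteq> {i. G i \<noteq> 0} \<union> {..p}" by (auto simp: not_le)
  then show ?thesis using assms(1) by (auto intro: finite_subset)
qed

lemma finite_support_funs_natLeq:
  "finite_support_funs natLeq natLeq = {f. finite {i. f i \<noteq> 0}}"
proof -
  have "underS natLeq (m :: nat) \<noteq> {} \<longleftrightarrow> m \<noteq> 0" for m by (auto simp: natLeq_underS_less)
  then show ?thesis by (simp add: finite_support_funs_def Field_natLeq Func_def)
qed

lemma order_pow_natLeq:
  "(f, g) \<in> order_pow natLeq natLeq \<and> f \<noteq> g \<longleftrightarrow>
     finite {i. f i \<noteq> 0} \<and> finite {i. g i \<noteq> 0} \<and> antilex f g"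
proof -
  have "(\<exists>y \<in> Field natLeq. (f y, g y) \<in> natLeq \<and> f y \<noteq> g y \<and>
            (\<forall>z \<in> Field natLeq. (y, z) \<in> natLeq \<and> y \<noteq> z \<longrightarrow> f z = g z)) \<longleftrightarrow> antilex f g"
    unfolding antilex_def Field_natLeq by (simp add: natLeq_def order_less_le)
  then show ?thesis
    using antilex_irrefl[of f] by (auto simp: order_pow_def finite_support_funs_natLeq)
qed

lemma below_order_pow_coordinates:
  assumes "(\<alpha>, order_pow natLeq natLeq) \<in> ordLess"
  shows "\<exists>\<kappa> G. finite {i. G i \<noteq> 0} \<and> bij_betw \<kappa> (Field \<alpha>) {g. antilex g G} \<and>
    (\<forall>x\<in>Field \<alpha>. \<forall>y\<in>Field \<alpha>. (x, y) \<in> \<alpha> \<and> x \<noteq> y \<longleftrightarrow> antilex (\<kappa> x) (\<kappa> y))"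
proof -
  let ?W = "order_pow natLeq natLeq"
  have wo: "Well_order ?W" "Well_order \<alpha>" using assms by (auto simp: ordLess_def)
  obtain G where G: "G \<in> Field ?W" "(\<alpha>, Restr ?W (underS ?W G)) \<in> ordIso"
    using assms ordLess_iff_ordIso_Restr[OF wo] by blast
  then obtain \<kappa> where iso: "iso \<alpha> (Restr ?W (underS ?W G)) \<kappa>" by (auto simp: ordIso_def)
  have finG: "finite {i. G i \<noteq> 0}"
    using G(1) by (auto simp: Field_def order_pow_def finite_support_funs_natLeq)
  have under: "underS ?W G = {g. antilex g G}"
    using order_pow_natLeq[of _ G] finite_support_antilex[OF finG] finG
    unfolding underS_def by blast
  have "Refl ?W" using wo(1) by (auto simp: order_on_defs)
  moreover have "underS ?W G \<subseteq> Field ?W" by (auto simp: underS_def Field_def)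
  ultimately have field: "Field (Restr ?W (underS ?W G)) = {g. antilex g G}"
    using Refl_Field_Restr2 under by metis
  have bij: "bij_betw \<kappa> (Field \<alpha>) {g. antilex g G}" using iso by (simp add: iso_iff2 field)
  have "(x, y) \<in> \<alpha> \<and> x \<noteq> y \<longleftrightarrow> antilex (\<kappa> x) (\<kappa> y)" if xy: "x \<in> Field \<alpha>" "y \<in> Field \<alpha>" for x y
  proof -
    have "antilex (\<kappa> x) G" "antilex (\<kappa> y) G" using bij xy by (auto simp: bij_betw_def)
    moreover have "x \<noteq> y \<longleftrightarrow> \<kappa> x \<noteq> \<kappa> y" using bij xy by (auto simp: bij_betw_def inj_on_def)
    moreover have "(x, y) \<in> \<alpha> \<longleftrightarrow> (\<kappa> x, \<kappa> y) \<in> Restr ?W (underS ?W G)"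
      using iso xy by (simp add: iso_iff2)
    ultimately show ?thesis
      using order_pow_natLeq[of "\<kappa> x" "\<kappa> y"] finite_support_antilex[OF finG] by (auto simp: under)
  qed
  then show ?thesis using finG bij by blast
qed

text \<open>
  The coordinate function of \<open>(m, z)\<close> is that of \<open>z\<close> shifted by one place, with \<open>m\<close> at place 0.  As
  \<open>m\<close> is unrestricted, the bound \<open>F\<close> is the shifted bound of \<open>\<alpha>\<close> with value 0 at place 0, and a
  function below \<open>F\<close> cannot have its decisive difference there.  Hence all summands of \<open>\<omega>\<alpha>\<close> have
  exponent at least 1.
\<close>

lemma order_mult_coordinates:
  assumes "(\<alpha>, order_pow natLeq natLeq) \<in> ordLess"
    and A: "same_order_type A (order_mult natLeq \<alpha>)"
  shows "\<exists>\<eta> F. finite {i. F i \<noteq> 0} \<and> F 0 = 0 \<and> bij_betw \<eta> (Field A) {h. antilex h F} \<and>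
    (\<forall>x\<in>Field A. \<forall>y\<in>Field A. (x, y) \<in> A \<and> x \<noteq> y \<longleftrightarrow> antilex (\<eta> x) (\<eta> y))"
proof -
  obtain \<kappa> G where G: "finite {i. G i \<noteq> 0}" and bij: "bij_betw \<kappa> (Field \<alpha>) {g. antilex g G}"
    and ord: "\<And>x y. x \<in> Field \<alpha> \<Longrightarrow> y \<in> Field \<alpha> \<Longrightarrow> (x, y) \<in> \<alpha> \<and> x \<noteq> y \<longleftrightarrow> antilex (\<kappa> x) (\<kappa> y)"
    using below_order_pow_coordinates[OF assms(1)] by blast
  let ?M = "order_mult natLeq \<alpha>"
  obtain f where iso: "iso A ?M f" using A by (auto simp: same_order_type_def)
  have field: "Field ?M = UNIV \<times> Field \<alpha>"
    by (auto simp: order_mult_def Field_def natLeq_def)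
  define \<eta> where "\<eta> = (\<lambda>(m, z). case_nat m (\<kappa> z)) \<circ> f"
  have f_bij: "bij_betw f (Field A) (UNIV \<times> Field \<alpha>)" using iso by (simp add: iso_iff2 field)
  have "bij_betw (\<lambda>(m, z). case_nat m (\<kappa> z)) (UNIV \<times> Field \<alpha>) {h. antilex h (case_nat 0 G)}"
    unfolding bij_betw_def
  proof (intro conjI inj_onI equalityI subsetI)
    fix u v assume uv: "u \<in> UNIV \<times> Field \<alpha>" "v \<in> UNIV \<times> Field \<alpha>"
      "(case u of (m, z) \<Rightarrow> case_nat m (\<kappa> z)) = (case v of (m, z) \<Rightarrow> case_nat m (\<kappa> z))"
    obtain m z m' z' where [simp]: "u = (m, z)" "v = (m', z')" by fastforce
    have eq: "case_nat m (\<kappa> z) i = case_nat m' (\<kappa> z') i" for i using uv(3) by simp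
    have "m = m'" using eq[of 0] by simp
    moreover have "\<kappa> z = \<kappa> z'" using eq[of "Suc _"] by auto
    ultimately show "u = v" using bij uv by (auto simp: bij_betw_def inj_on_def)
  next
    fix h assume "h \<in> (\<lambda>(m, z). case_nat m (\<kappa> z)) ` (UNIV \<times> Field \<alpha>)"
    then show "h \<in> {h. antilex h (case_nat 0 G)}"
      using bij by (auto simp: antilex_case_nat bij_betw_def)
  next
    fix h assume "h \<in> {h. antilex h (case_nat 0 G)}"
    moreover have h: "h = case_nat (h 0) (\<lambda>i. h (Suc i))" by (auto split: nat.split)
    ultimately have "antilex (\<lambda>i. h (Suc i)) G"
      using antilex_case_nat[of "h 0" "\<lambda>i. h (Suc i)" 0 G] by simp
    then obtain z where "z \<in> Field \<alpha>" "\<kappa> z = (\<lambda>i. h (Suc i))"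
      using bij unfolding bij_betw_def by (metis imageE mem_Collect_eq)
    then show "h \<in> (\<lambda>(m, z). case_nat m (\<kappa> z)) ` (UNIV \<times> Field \<alpha>)"
      using h by (intro image_eqI[of _ _ "(h 0, z)"]) auto
  qed
  with f_bij have "bij_betw \<eta> (Field A) {h. antilex h (case_nat 0 G)}"
    unfolding \<eta>_def by (rule bij_betw_trans)
  moreover have "(x, y) \<in> A \<and> x \<noteq> y \<longleftrightarrow> antilex (\<eta> x) (\<eta> y)"
    if xy: "x \<in> Field A" "y \<in> Field A" for x y
  proof -
    obtain m z m' z' where f: "f x = (m, z)" "f y = (m', z')" by fastforce
    have z: "z \<in> Field \<alpha>" "z' \<in> Field \<alpha>"
      using f bij_betw_apply[OF f_bij xy(1)] bij_betw_apply[OF f_bij xy(2)] by auto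
    have "x \<noteq> y \<longleftrightarrow> f x \<noteq> f y" using f_bij xy by (auto simp: bij_betw_def inj_on_def)
    moreover have "(x, y) \<in> A \<longleftrightarrow> (f x, f y) \<in> ?M" using iso xy by (simp add: iso_iff2)
    moreover have "z = z' \<longleftrightarrow> \<kappa> z = \<kappa> z'" using bij z by (auto simp: bij_betw_def inj_on_def)
    ultimately show ?thesis
      using ord[OF z] z by (auto simp: f \<eta>_def antilex_case_nat order_mult_def Field_natLeq) (auto simp: natLeq_def)
  qed
  moreover have "finite {i. case_nat 0 G i \<noteq> 0}"
  proof -
    have "{i. case_nat 0 G i \<noteq> 0} \<subseteq> Suc ` {i. G i \<noteq> 0}"
    proof
      fix i assume "i \<in> {i. case_nat 0 G i \<noteq> 0}"
      then show "i \<in> Suc ` {i. G i \<noteq> 0}" by (cases i) auto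
    qed
    then show ?thesis using G by (auto intro: finite_subset)
  qed
  ultimately show ?thesis by (intro exI[of _ \<eta>] exI[of _ "case_nat 0 G"]) auto
qed

section \<open>Summands that are powers of \<open>\<omega>\<close>\<close>

text \<open>
  The point that \<open>S\<close> names in the summand \<open>(y, v)\<close>.  The elements of \<open>S\<close> are written increasingly
  from place \<open>y - 1\<close> down to place 0, so that the least element of \<open>S\<close> is the most significant value.
\<close>

definition piece_point :: "(nat \<Rightarrow> nat) \<Rightarrow> nat \<Rightarrow> nat \<Rightarrow> nat set \<Rightarrow> nat \<Rightarrow> nat" where
  "piece_point F y v S =
     (\<lambda>j. if j < y then sorted_list_of_set S ! (y - Suc j) else if j = y then v else F j)"

lemma antilex_piece_point: "v < F y \<Longrightarrow> antilex (piece_point F y v S) F"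
  by (auto simp: antilex_def piece_point_def intro!: exI[of _ y])

lemma piece_point_inject:
  assumes "S \<in> nsets UNIV y" "T \<in> nsets UNIV y" "piece_point F y v S = piece_point F y v T"
  shows "S = T"
proof -
  have "sorted_list_of_set S ! i = sorted_list_of_set T ! i" if "i < y" for i
    using fun_cong[OF assms(3), of "y - Suc i"] that by (simp add: piece_point_def)
  then have "sorted_list_of_set S = sorted_list_of_set T"
    using assms(1,2) by (auto simp: nsets_def intro: nth_equalityI)
  then show ?thesis using assms(1,2) by (auto simp: nsets_def sorted_list_of_set_inject)
qed

text \<open>
  Let \<open>y\<close> be the largest place where \<open>h\<close> differs from \<open>F\<close>.  The values of \<open>h\<close> below \<open>y\<close> are
  arbitrary, whereas those of a point named by a subset of \<open>H\<close> must lie in \<open>H\<close> and increase towards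
  place 0.  Replacing them by their partial sums from place \<open>y - 1\<close> downwards, each value
  increased by one, makes them strictly increasing; enumerating \<open>H\<close> along these sums puts them into \<open>H\<close>.
  If \<open>h\<close> and \<open>k\<close> first differ, read from above, at \<open>p\<close>, then the partial sums agree above \<open>p\<close>
  and compare at \<open>p\<close> in the same way as \<open>h\<close> and \<open>k\<close>.
\<close>

lemma strict_mono_into_pieces:
  assumes H: "infinite (H :: nat set)"
  shows "\<exists>\<phi>. (\<forall>h. antilex h F \<longrightarrow>
            (\<exists>y v S. v < F y \<and> S \<in> nsets H y \<and> \<phi> h = piece_point F y v S)) \<and>
          (\<forall>h k. antilex h F \<longrightarrow> antilex k F \<longrightarrow> antilex h k \<longrightarrow> antilex (\<phi> h) (\<phi> k))"
proof -
  define e where "e = enumerate H"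
  have e_mono: "e i < e j \<longleftrightarrow> i < j" for i j using H by (simp add: e_def)
  have e_H: "e i \<in> H" for i using H by (simp add: e_def enumerate_in_set)
  \<comment> \<open>for \<open>h\<close> below \<open>F\<close>, the largest place where they differ\<close>
  define lead where "lead h = (SOME p. h p < F p \<and> (\<forall>z>p. h z = F z))" for h
  have lead_props: "h (lead h) < F (lead h) \<and> (\<forall>z>lead h. h z = F z)" if "antilex h F" for h
    unfolding lead_def by (rule someI_ex) (use that in \<open>simp add: antilex_def\<close>)
  have lead: "h (lead h) < F (lead h)" "\<And>z. z > lead h \<Longrightarrow> h z = F z" if "antilex h F" for h
    using lead_props[OF that] by blast+
  define \<sigma> where "\<sigma> h j = (\<Sum>i\<in>{j..<lead h}. Suc (h i))" for h j
  define \<phi> where "\<phi> h j = (if j < lead h then e (\<sigma> h j) else h j)" for h j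
  have \<sigma>_less: "\<sigma> h j < \<sigma> h i" if "i < j" "j \<le> lead h" for h i j
  proof -
    have "\<sigma> h i = (\<Sum>l\<in>{i..<j}. Suc (h l)) + \<sigma> h j"
      unfolding \<sigma>_def using that by (simp add: sum.atLeastLessThan_concat)
    moreover have "0 < (\<Sum>l\<in>{i..<j}. Suc (h l))" using that by (auto simp: sum_pos)
    ultimately show ?thesis by simp
  qed
  have "\<exists>y v S. v < F y \<and> S \<in> nsets H y \<and> \<phi> h = piece_point F y v S" if h: "antilex h F" for h
  proof -
    define f where "f i = e (\<sigma> h (lead h - Suc i))" for i
    have f: "strict_mono_on {..<lead h} f"
      by (auto simp: strict_mono_on_def f_def e_mono intro!: \<sigma>_less)
    define S where "S = f ` {..<lead h}"
    have S: "S \<in> nsets H (lead h)"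
      using strict_mono_on_imp_inj_on[OF f] e_H card_image by (fastforce simp: S_def nsets_def f_def)
    have nth: "sorted_list_of_set S ! i = e (\<sigma> h (lead h - Suc i))" if "i < lead h" for i
      unfolding S_def sorted_list_of_set_strict_mono_image[OF f] using that by (simp add: f_def)
    have "\<phi> h = piece_point F (lead h) (h (lead h)) S"
    proof
      fix j
      show "\<phi> h j = piece_point F (lead h) (h (lead h)) S j"
        using lead(2)[OF h, of j] by (auto simp: nth \<phi>_def piece_point_def)
    qed
    then show ?thesis using S lead(1)[OF h] by blast
  qed
  moreover have "antilex (\<phi> h) (\<phi> k)"
    if h: "antilex h F" and k: "antilex k F" and hk: "antilex h k" for h k
  proof -
    obtain p where p: "h p < k p" "\<And>z. z > p \<Longrightarrow> h z = k z" using hk by (auto simp: antilex_def)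
    have above: "h z = F z \<longleftrightarrow> k z = F z" if "z > p" for z using p(2)[OF that] by simp
    have lead_neq: "h (lead h) \<noteq> F (lead h)" "k (lead k) \<noteq> F (lead k)" using lead(1) h k by (metis less_irrefl)+
    \<comment> \<open>\<open>h\<close> and \<open>k\<close> lie in different summands, and \<open>\<phi>\<close> changes neither of them at \<open>p\<close> or above\<close>
    have "antilex (\<phi> h) (\<phi> k)" if low: "lead h \<le> p" "lead k \<le> p"
      unfolding antilex_def using p low by (intro exI[of _ p]) (auto simp: \<phi>_def)
    moreover have "antilex (\<phi> h) (\<phi> k)" if high: "p < lead h \<or> p < lead k"
    proof -
      \<comment> \<open>\<open>h\<close> and \<open>k\<close> agree above \<open>p\<close>, hence differ from \<open>F\<close> at the same places above \<open>p\<close>\<close>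
      have same: "lead h = lead k" and hi: "p < lead k"
        using high lead_neq above lead(2)[OF h] lead(2)[OF k] by (metis nat_neq_iff order.strict_trans)+
      have \<sigma>_eq: "\<sigma> h j = \<sigma> k j" if "j > p" for j
        unfolding \<sigma>_def same using p(2) that by (intro sum.cong) auto
      have \<sigma>_rec: "\<sigma> l p = Suc (l p) + \<sigma> l (Suc p)" if "p < lead l" for l
        unfolding \<sigma>_def using that by (simp add: sum.atLeast_Suc_lessThan)
      have "\<sigma> h p < \<sigma> k p"
        using p(1) hi same \<sigma>_eq[of "Suc p"] by (simp add: \<sigma>_rec)
      then show ?thesis
        unfolding antilex_def using hi same p(2)
        by (intro exI[of _ p]) (auto simp: \<phi>_def e_mono \<sigma>_eq)
    qed
    ultimately show ?thesis by linarith
  qed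
  ultimately show ?thesis by blast
qed

text \<open>
  This is all that the colouring argument needs to know about \<open>\<omega>\<alpha>\<close>.  A summand \<open>p = (y, v)\<close> has exponent
  \<open>fst p\<close>, and \<open>a p S\<close> is the point of \<open>A\<close> that \<open>S\<close> names in it.
\<close>

lemma omega_multiple_pieces:
  fixes A :: "'x rel"
  assumes "(\<alpha>, order_pow natLeq natLeq) \<in> ordLess"
    and A: "same_order_type A (order_mult natLeq \<alpha>)"
  obtains P :: "(nat \<times> nat) set" and a :: "nat \<times> nat \<Rightarrow> nat set \<Rightarrow> 'x"
  where "finite P" and "\<And>p. p \<in> P \<Longrightarrow> 0 < fst p"
    and "\<And>p. p \<in> P \<Longrightarrow> a p ` nsets UNIV (fst p) \<subseteq> Field A"
    and "\<And>p. p \<in> P \<Longrightarrow> inj_on (a p) (nsets UNIV (fst p))"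
    and "\<And>H. infinite H \<Longrightarrow> \<exists>C \<subseteq> (\<Union>p\<in>P. a p ` nsets H (fst p)).
           same_order_type (Restr A C) (order_mult natLeq \<alpha>)"
proof -
  obtain \<eta> F where F: "finite {i. F i \<noteq> 0}" "F 0 = (0 :: nat)"
    and bij: "bij_betw \<eta> (Field A) {h. antilex h F}"
    and ord: "\<And>x y. x \<in> Field A \<Longrightarrow> y \<in> Field A \<Longrightarrow> (x, y) \<in> A \<and> x \<noteq> y \<longleftrightarrow> antilex (\<eta> x) (\<eta> y)"
    using order_mult_coordinates[OF assms] by blast
  define g where "g = inv_into (Field A) \<eta>"
  have g_bij: "bij_betw g {h. antilex h F} (Field A)"
    unfolding g_def by (rule bij_betw_inv_into[OF bij])
  have \<eta>_g: "\<eta> (g h) = h" if "antilex h F" for h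
    unfolding g_def using bij_betw_inv_into_right[OF bij] that by simp
  have \<eta>_below: "antilex (\<eta> x) F" if "x \<in> Field A" for x
    using bij_betw_apply[OF bij that] by simp
  define P where "P = (SIGMA y:{y. F y \<noteq> 0}. {..<F y})"
  define a where "a = (\<lambda>(y, v) S. g (piece_point F y v S))"
  have "finite P" unfolding P_def using F(1) by auto
  moreover have "0 < fst p" if "p \<in> P" for p
    using that F(2) by (cases "fst p = 0") (auto simp: P_def)
  moreover have "a p ` nsets UNIV (fst p) \<subseteq> Field A" "inj_on (a p) (nsets UNIV (fst p))"
    if p: "p \<in> P" for p
  proof -
    obtain y v where [simp]: "p = (y, v)" and v: "v < F y" using p by (auto simp: P_def)
    note below = antilex_piece_point[where F = F, OF v]
    show "a p ` nsets UNIV (fst p) \<subseteq> Field A"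
      using bij_betw_apply[OF g_bij] below by (auto simp: a_def)
    show "inj_on (a p) (nsets UNIV (fst p))"
    proof (rule inj_onI)
      fix S T assume ST: "S \<in> nsets UNIV (fst p)" "T \<in> nsets UNIV (fst p)" "a p S = a p T"
      then have "piece_point F y v S = piece_point F y v T"
        using \<eta>_g[OF below] by (metis \<open>p = (y, v)\<close> a_def case_prod_conv)
      then show "S = T" using ST piece_point_inject by simp
    qed
  qed
  moreover have "\<exists>C \<subseteq> (\<Union>p\<in>P. a p ` nsets H (fst p)).
      same_order_type (Restr A C) (order_mult natLeq \<alpha>)" if H: "infinite H" for H
  proof -
    obtain \<phi> where piece: "\<And>h. antilex h F \<Longrightarrow>
            \<exists>y v S. v < F y \<and> S \<in> nsets H y \<and> \<phi> h = piece_point F y v S"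
      and mono: "\<And>h k. antilex h F \<Longrightarrow> antilex k F \<Longrightarrow> antilex h k \<Longrightarrow> antilex (\<phi> h) (\<phi> k)"
      using strict_mono_into_pieces[OF H, of F] by blast
    define \<theta> where "\<theta> x = g (\<phi> (\<eta> x))" for x
    have \<phi>_below: "antilex (\<phi> h) F" if "antilex h F" for h
      using piece[OF that] antilex_piece_point by metis
    have \<theta>_Field: "\<theta> x \<in> Field A" if "x \<in> Field A" for x
      using bij_betw_apply[OF g_bij] \<phi>_below \<eta>_below[OF that] by (simp add: \<theta>_def)
    have \<eta>_\<theta>: "\<eta> (\<theta> x) = \<phi> (\<eta> x)" if "x \<in> Field A" for x
      unfolding \<theta>_def using that by (intro \<eta>_g \<phi>_below \<eta>_below)
    have "same_order_type (Restr A (\<theta> ` Field A)) (order_mult natLeq \<alpha>)"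
    proof (rule same_order_type_strict_mono_image[OF A])
      show "\<theta> ` Field A \<subseteq> Field A" using \<theta>_Field by blast
    next
      fix x y assume xy: "x \<in> Field A" "y \<in> Field A" "(x, y) \<in> A" "x \<noteq> y"
      then have "antilex (\<eta> (\<theta> x)) (\<eta> (\<theta> y))"
        using mono[of "\<eta> x" "\<eta> y"] \<eta>_below ord[of x y] by (simp add: \<eta>_\<theta>)
      then show "(\<theta> x, \<theta> y) \<in> A \<and> \<theta> x \<noteq> \<theta> y" using ord \<theta>_Field xy by blast
    qed
    moreover have "\<theta> ` Field A \<subseteq> (\<Union>p\<in>P. a p ` nsets H (fst p))"
    proof
      fix z assume "z \<in> \<theta> ` Field A"
      then obtain x where x: "x \<in> Field A" "z = \<theta> x" by blast
      then obtain y v S where "v < F y" "S \<in> nsets H y" "\<phi> (\<eta> x) = piece_point F y v S"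
        using piece \<eta>_below by blast
      then have "(y, v) \<in> P" "z = a (y, v) S" "S \<in> nsets H (fst (y, v))"
        using x by (auto simp: P_def a_def \<theta>_def)
      then show "z \<in> (\<Union>p\<in>P. a p ` nsets H (fst p))" by blast
    qed
    ultimately show ?thesis by blast
  qed
  ultimately show ?thesis by (rule that[of P a])
qed

theorem theorem5p12:
  fixes \<alpha> :: "'a rel" and \<beta> :: "'b rel" and n :: nat
  assumes "(\<alpha>, order_pow natLeq natLeq) \<in> ordLess"
    and "(\<beta>, order_pow natLeq natLeq) \<in> ordLess"
  shows "polarised_partition TYPE('x) TYPE('y)
           (order_mult natLeq \<alpha>) (order_mult natLeq \<beta>)
           (order_mult natLeq \<alpha>) (order_mult natLeq \<beta>)
           (natLeq_on n) (natLeq_on n)"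
  unfolding polarised_partition_def
proof (intro allI impI disjCI)
  fix A :: "'x rel" and B :: "'y rel" and c :: "'x \<times> 'y \<Rightarrow> nat"
  assume *: "same_order_type A (order_mult natLeq \<alpha>) \<and> same_order_type B (order_mult natLeq \<beta>) \<and>
    c ` (Field A \<times> Field B) \<subseteq> {0, 1}"
  assume no_square: "\<nexists>E Z. E \<subseteq> Field A \<and> same_order_type (Restr A E) (natLeq_on n) \<and>
    Z \<subseteq> Field B \<and> same_order_type (Restr B Z) (natLeq_on n) \<and> c ` (E \<times> Z) \<subseteq> {1}"
  have lin: "Linear_order A" "Linear_order B" using * by (auto simp: same_order_type_def)
  obtain P :: "(nat \<times> nat) set" and a :: "nat \<times> nat \<Rightarrow> nat set \<Rightarrow> 'x" where P:
    "finite P" "\<And>p. p \<in> P \<Longrightarrow> 0 < fst p"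
    "\<And>p. p \<in> P \<Longrightarrow> a p ` nsets UNIV (fst p) \<subseteq> Field A"
    "\<And>p. p \<in> P \<Longrightarrow> inj_on (a p) (nsets UNIV (fst p))"
    "\<And>H. infinite H \<Longrightarrow> \<exists>C \<subseteq> (\<Union>p\<in>P. a p ` nsets H (fst p)).
        same_order_type (Restr A C) (order_mult natLeq \<alpha>)"
    by (rule omega_multiple_pieces[OF assms(1) conjunct1[OF *]]) (rule that)
  obtain P' :: "(nat \<times> nat) set" and b :: "nat \<times> nat \<Rightarrow> nat set \<Rightarrow> 'y" where P':
    "finite P'" "\<And>q. q \<in> P' \<Longrightarrow> 0 < fst q"
    "\<And>q. q \<in> P' \<Longrightarrow> b q ` nsets UNIV (fst q) \<subseteq> Field B"
    "\<And>q. q \<in> P' \<Longrightarrow> inj_on (b q) (nsets UNIV (fst q))"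
    "\<And>H. infinite H \<Longrightarrow> \<exists>D \<subseteq> (\<Union>q\<in>P'. b q ` nsets H (fst q)).
        same_order_type (Restr B D) (order_mult natLeq \<beta>)"
    by (rule omega_multiple_pieces[OF assms(2) conjunct1[OF conjunct2[OF *]]]) (rule that)
  have "\<exists>H. infinite H \<and> (\<forall>p\<in>P. \<forall>q\<in>P'. \<forall>S\<in>nsets H (fst p). \<forall>T\<in>nsets H (fst q).
           S \<inter> T = {} \<longrightarrow> \<not> c (a p S, b q T) = 1)"
  proof (rule square_free_imp_disjoint_independent[OF P(1) P'(1) P(2) P'(2)])
    fix p q S T
    assume pq: "p \<in> P" "q \<in> P'" and inj: "inj_on S {..<n}" "inj_on T {..<n}"
      and S: "\<And>i. i < n \<Longrightarrow> S i \<in> nsets UNIV (fst p)"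
      and T: "\<And>j. j < n \<Longrightarrow> T j \<in> nsets UNIV (fst q)"
      and one: "\<And>i j. i < n \<Longrightarrow> j < n \<Longrightarrow> c (a p (S i), b q (T j)) = 1"
    let ?E = "(\<lambda>i. a p (S i)) ` {..<n}" and ?Z = "(\<lambda>j. b q (T j)) ` {..<n}"
    have sub: "?E \<subseteq> Field A" "?Z \<subseteq> Field B"
      using P(3)[OF pq(1)] P'(3)[OF pq(2)] S T by (auto simp: image_subset_iff)
    have "inj_on (\<lambda>i. a p (S i)) {..<n}" "inj_on (\<lambda>j. b q (T j)) {..<n}"
      using comp_inj_on[OF inj(1) inj_on_subset[OF P(4)[OF pq(1)]]] S
        comp_inj_on[OF inj(2) inj_on_subset[OF P'(4)[OF pq(2)]]] T
      by (auto simp: comp_def image_subset_iff)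
    then have "same_order_type (Restr A ?E) (natLeq_on n)" "same_order_type (Restr B ?Z) (natLeq_on n)"
      using sub lin by (auto intro!: same_order_type_finite_Restr simp: card_image)
    moreover have "c ` (?E \<times> ?Z) \<subseteq> {1}" using one by auto
    ultimately show False using no_square sub by blast
  qed auto
  then obtain H where H: "infinite H" "\<And>p q S T. p \<in> P \<Longrightarrow> q \<in> P' \<Longrightarrow>
      S \<in> nsets H (fst p) \<Longrightarrow> T \<in> nsets H (fst q) \<Longrightarrow> S \<inter> T = {} \<Longrightarrow> c (a p S, b q T) \<noteq> 1" by metis
  obtain H\<^sub>1 H\<^sub>2 where split: "H\<^sub>1 \<subseteq> H" "H\<^sub>2 \<subseteq> H" "infinite H\<^sub>1" "infinite H\<^sub>2" "H\<^sub>1 \<inter> H\<^sub>2 = {}"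
    using infinite_split_nat[OF H(1)] by blast
  obtain C where C: "C \<subseteq> (\<Union>p\<in>P. a p ` nsets H\<^sub>1 (fst p))"
    "same_order_type (Restr A C) (order_mult natLeq \<alpha>)" using P(5)[OF split(3)] by blast
  obtain D where D: "D \<subseteq> (\<Union>q\<in>P'. b q ` nsets H\<^sub>2 (fst q))"
    "same_order_type (Restr B D) (order_mult natLeq \<beta>)" using P'(5)[OF split(4)] by blast
  have CF: "C \<subseteq> Field A" using C(1) P(3) nsets_mono[of H\<^sub>1 UNIV] by fast
  have DF: "D \<subseteq> Field B" using D(1) P'(3) nsets_mono[of H\<^sub>2 UNIV] by fast
  have "c (x, y) = 0" if "x \<in> C" "y \<in> D" for x y
  proof -
    from that C(1) D(1) obtain p q S T where pq: "p \<in> P" "q \<in> P'" "x = a p S" "y = b q T"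
      and ST: "S \<in> nsets H\<^sub>1 (fst p)" "T \<in> nsets H\<^sub>2 (fst q)" by blast
    have disj: "S \<inter> T = {}" using ST split(5) by (auto simp: nsets_def)
    have "S \<in> nsets H (fst p)" "T \<in> nsets H (fst q)"
      using ST split(1,2) by (auto simp: nsets_def)
    then have "c (x, y) \<noteq> 1" unfolding pq(3,4) by (rule H(2)[OF pq(1,2) _ _ disj])
    moreover have "c (x, y) \<in> {0, 1}" using that CF DF * by blast
    ultimately show ?thesis by blast
  qed
  then have "c ` (C \<times> D) \<subseteq> {0}" by auto
  then show "\<exists>C D. C \<subseteq> Field A \<and> same_order_type (Restr A C) (order_mult natLeq \<alpha>) \<and>
      D \<subseteq> Field B \<and> same_order_type (Restr B D) (order_mult natLeq \<beta>) \<and> c ` (C \<times> D) \<subseteq> {0}"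
    using C(2) D(2) CF DF by blast
qed

end
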